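(* Let $f_{0,\infty}=(f_0,f_1,\ldots)$ be a sequence of continuous self-maps of $I=[0,1]$ converging uniformly to a continuous map $f\colon I\to I$. If $f$ is nonchaotic stable, then $f_{0,\infty}$ is nonchaotic with respect to small random perturbations.
   Context: $\mathrm{Per}(f)$ denotes the set of periodic points of $f$ ($p$ with $f^n(p)=p$ for some $n\in\mathbb{N}$). $f$ is nonchaotic stable if for each $\varepsilon>0$ there exists $\delta>0$ such that for every continuous $g\colon I\to I$ with $\sup_{x\in I}|f(x)-g(x)|<\delta$ and every $x\in I$ there is a periodic point $p$ of $g$ with $\limsup_{n\to\infty}|g^n(x)-g^n(p)|<\varepsilon$. For a sequence $g_{0,\infty}$ and $k\in\mathbb{N}_0$, $g_{k,\infty}=(g_k,g_{k+1},\ldots)$. Each map $g$ in the sequence is extended continuously to $\mathbb{R}$ so that $g(\mathbb{R}\setminus I)\subseteq g(\{0,1\})$. Fix a probability space $(\Omega,\Sigma,P)$. For $\delta>0$, a $(g_{0,\infty},\delta)$-process beginning at $x_0$ is given by $X_0=x_0$, $X_{n+1}=g_n(X_n)+\xi_n$, where $\xi_0,\xi_1,\ldots$ are independent with uniform continuous distribution on $[-\delta,\delta]$. A sequence $f_{0,\infty}$ converging uniformly to $f$ is nonchaotic with respect to small random perturbations if for each $\varepsilon>0$ there exist $K\in\mathbb{N}$ and $\delta>0$ such that for each integer $k>K$, each $\delta'\in(0,\delta)$ and each $x_0\in I$, $P\big(\exists p\in\mathrm{Per}(f)\colon \limsup_{n\to\infty}|X_n-f^n(p)|<\varepsilon\big)=1$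 for every $(f_{k,\infty},\delta')$-process $(X_n)$ beginning at $x_0$. *)

theory Defs
  imports "HOL-Probability.Probability"
begin

abbreviation unitI :: "real set" where "unitI \<equiv> {0..1}"

definition self_map_I :: "(real \<Rightarrow> real) \<Rightarrow> bool" where
  "self_map_I g \<longleftrightarrow> continuous_on unitI g \<and> g ` unitI \<subseteq> unitI"

definition Per :: "(real \<Rightarrow> real) \<Rightarrow> real set" where
  "Per g = {p \<in> unitI. \<exists>n::nat. n \<ge> 1 \<and> (g ^^ n) p = p}"

text \<open>The (unique) continuous extension of g to the reals with g(R - I) contained in g({0,1}).\<close>
definition ext_I :: "(real \<Rightarrow> real) \<Rightarrow> real \<Rightarrow> real" where
  "ext_I g x = g (max 0 (min 1 x))"

definition nonchaotic_stable :: "(real \<Rightarrow> real) \<Rightarrow> bool" where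
  "nonchaotic_stable f \<longleftrightarrow>
    (\<forall>\<epsilon>>0. \<exists>\<delta>>0. \<forall>g. self_map_I g \<and> (SUP x\<in>unitI. \<bar>f x - g x\<bar>) < \<delta> \<longrightarrow>
       (\<forall>x\<in>unitI. \<exists>p\<in>Per g.
          limsup (\<lambda>n. ereal \<bar>(g ^^ n) x - (g ^^ n) p\<bar>) < ereal \<epsilon>))"

primrec rproc :: "(nat \<Rightarrow> real \<Rightarrow> real) \<Rightarrow> (nat \<Rightarrow> 'a \<Rightarrow> real) \<Rightarrow> real \<Rightarrow> nat \<Rightarrow> 'a \<Rightarrow> real" where
  "rproc gs \<xi> x0 0 \<omega> = x0"
| "rproc gs \<xi> x0 (Suc n) \<omega> = ext_I (gs n) (rproc gs \<xi> x0 n \<omega>) + \<xi> n \<omega>"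

definition uniform_noise :: "'a measure \<Rightarrow> real \<Rightarrow> (nat \<Rightarrow> 'a \<Rightarrow> real) \<Rightarrow> bool" where
  "uniform_noise M \<delta> \<xi> \<longleftrightarrow>
     prob_space.indep_vars M (\<lambda>_. borel) \<xi> UNIV \<and>
     (\<forall>n. distr M lborel (\<xi> n) = uniform_measure lborel {-\<delta>..\<delta>})"

definition nonchaotic_rp :: "'a measure \<Rightarrow> (nat \<Rightarrow> real \<Rightarrow> real) \<Rightarrow> (real \<Rightarrow> real) \<Rightarrow> bool" where
  "nonchaotic_rp M fs f \<longleftrightarrow>
    (\<forall>\<epsilon>>0. \<exists>K::nat. \<exists>\<delta>>0. \<forall>k>K. \<forall>\<delta>'. 0 < \<delta>' \<and> \<delta>' < \<delta> \<longrightarrow>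
       (\<forall>x0\<in>unitI. \<forall>\<xi>. uniform_noise M \<delta>' \<xi> \<longrightarrow>
         (AE \<omega> in M. \<exists>p\<in>Per f.
            limsup (\<lambda>n. ereal \<bar>rproc (\<lambda>n. fs (k + n)) \<xi> x0 n \<omega> - (f ^^ n) p\<bar>) < ereal \<epsilon>)))"

end

theory Submission
  imports Defs
begin

text \<open>A pseudo-orbit of \<open>f\<close> is followed by a true orbit of a small perturbation of \<open>f\<close>: add a fast
  oscillation to \<open>f\<close> and use that intervals then cover intervals. By stability every pseudo-orbit is
  therefore almost periodic. If \<open>u\<close> and \<open>v\<close> are reached from \<open>a\<close> in the same number of steps and both
  lead back to \<open>a\<close>, one can concatenate pseudo-orbits that visit \<open>u\<close> and \<open>v\<close> in any prescribed
  order at equally spaced times; a non-periodic order forces \<open>u\<close> and \<open>v\<close> to be close.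

  Almost surely the accumulation set of the process is forward invariant under \<open>f\<close>, because the noise
  is small at infinitely many of the visits near any accumulation point. Hence, for an accumulation
  point \<open>a\<close> and a late time \<open>m\<close> at which the process is near \<open>a\<close>, both \<open>X (m + j)\<close> and
  \<open>(f ^^ j) a\<close> are reached from \<open>a\<close> in \<open>j\<close> steps and lead back to \<open>a\<close>, so they are close for all
  \<open>j\<close>, and stability with \<open>g = f\<close> provides the periodic point.\<close>

section \<open>Self-maps of the unit interval and their extension to the line\<close>

abbreviation clampI :: "real \<Rightarrow> real" where "clampI x \<equiv> max 0 (min 1 x)"

lemma clampI_dist: "y \<in> unitI \<Longrightarrow> \<bar>clampI x - y\<bar> \<le> \<bar>x - y\<bar>"
  by (auto simp: max_def min_def)

lemma continuous_on_ext_I: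
  assumes "self_map_I g"
  shows "continuous_on UNIV (ext_I g)"
proof -
  have "continuous_on UNIV (g \<circ> clampI)"
    by (intro continuous_on_compose continuous_intros)
      (use assms in \<open>auto simp: self_map_I_def intro: continuous_on_subset\<close>)
  then show ?thesis
    by (simp add: ext_I_def[abs_def] o_def)
qed

lemma ext_I_in:
  assumes "self_map_I g"
  shows "ext_I g x \<in> unitI"
  using assms unfolding self_map_I_def ext_I_def by (auto simp: image_subset_iff)

lemma ext_I_eq: "x \<in> unitI \<Longrightarrow> ext_I g x = g x"
  by (simp add: ext_I_def)

lemma self_map_I_funpow_in:
  assumes "self_map_I g" "x \<in> unitI"
  shows "(g ^^ n) x \<in> unitI"
  using assms by (induction n) (auto simp: self_map_I_def image_subset_iff)

section \<open>Perturbations whose true orbits follow pseudo-orbits\<close>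

text \<open>Finite itineraries are built backwards, since each point of \<open>J (Suc n)\<close> has
  a preimage in \<open>J n\<close>. The sets \<open>C n\<close> are therefore nonempty; they are
  nested closed subsets of \<open>J 0\<close>, so compactness gives one point for all times.\<close>

lemma itinerary_exists:
  fixes g :: "'a::heine_borel \<Rightarrow> 'a"
  assumes cont: "continuous_on UNIV g" and comp: "\<And>n. compact (J n)"
    and ne: "\<And>n. J n \<noteq> {}" and cover: "\<And>n. J (Suc n) \<subseteq> g ` J n"
  obtains x where "\<And>n. (g ^^ n) x \<in> J n"
proof -
  define C where "C n = (\<Inter>i\<in>{..n}. (g ^^ i) -` J i)" for n
  have cont_pow: "continuous_on UNIV (g ^^ n)" for n
  proof (induction n)
    case 0
    then show ?case by (simp add: continuous_on_id id_def)
  next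
    case (Suc n)
    then show ?case
      using cont continuous_on_compose[of UNIV "g ^^ n" g] by (auto intro: continuous_on_subset)
  qed
  have "closed (C n)" for n
    unfolding C_def
    by (intro closed_INT ballI closed_vimage compact_imp_closed comp cont_pow)
  moreover have "C n = J 0 \<inter> C n" for n
    unfolding C_def by auto
  ultimately have "compact (C n)" for n
    by (metis comp compact_Int_closed)
  moreover have "\<exists>x. (\<forall>i\<le>n. (g ^^ i) x \<in> J i) \<and> (g ^^ n) x = y" if "y \<in> J n" for n y
    using that
  proof (induction n arbitrary: y)
    case 0
    then show ?case by simp
  next
    case (Suc n)
    then obtain y' where "y' \<in> J n" "y = g y'"
      using cover by blast
    with Suc show ?case
      by (metis comp_apply funpow.simps(2) le_Suc_eq)
  qed
  then have "C n \<noteq> {}" for n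
    using ne[of n] by (fastforce simp: C_def)
  moreover have "C n \<subseteq> C m" if "m \<le> n" for m n
    using that unfolding C_def by fastforce
  ultimately have "\<Inter> (range C) \<noteq> {}"
    by (intro compact_nest)
  then show thesis
    using that by (auto simp: C_def)
qed

lemma arith_progression_meets_interval:
  fixes c t l :: real
  assumes "0 < l"
  shows "\<exists>k::int. t + l * of_int k \<in> {c..c + l}"
proof -
  define k where "k = \<lceil>(c - t) / l\<rceil>"
  have "(c - t) / l \<le> of_int k" "of_int k < (c - t) / l + 1"
    unfolding k_def by linarith+
  then have "c - t \<le> of_int k * l" "of_int k * l \<le> c - t + l"
    using assms by (auto simp: field_simps)
  then show ?thesis
    by (intro exI[of _ k]) (auto simp: mult.commute)
qed

lemma interval_contains_sin_extrema:
  fixes c l :: real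
  assumes "0 < l"
  obtains x y where "x \<in> {c..c + l}" "sin (2 * pi * x / l) = 1"
    "y \<in> {c..c + l}" "sin (2 * pi * y / l) = -1"
proof -
  obtain k where k: "l / 4 + l * of_int k \<in> {c..c + l}"
    using arith_progression_meets_interval[OF assms] by blast
  obtain j where j: "- l / 4 + l * of_int j \<in> {c..c + l}"
    using arith_progression_meets_interval[OF assms] by blast
  have "2 * pi * (l / 4 + l * of_int k) / l = pi / 2 + 2 * pi * of_int k"
    using assms by (simp add: field_simps)
  then have 1: "sin (2 * pi * (l / 4 + l * of_int k) / l) = 1"
    by (simp only: sin_add) simp
  have "2 * pi * (- l / 4 + l * of_int j) / l = - (pi / 2) + 2 * pi * of_int j"
    using assms by (simp add: field_simps)
  then have 2: "sin (2 * pi * (- l / 4 + l * of_int j) / l) = -1"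
    by (simp only: sin_add) simp
  show thesis
    using that[OF k 1 j 2] .
qed

lemma pseudo_orbit_realized:
  assumes f: "self_map_I f" and "\<rho> < r" "0 < r" "0 < \<epsilon>"
    and w_in: "\<And>n. w n \<in> unitI" and w_step: "\<And>n. \<bar>w (Suc n) - f (w n)\<bar> \<le> \<rho>"
  obtains g x where "self_map_I g" "\<And>y. y \<in> unitI \<Longrightarrow> \<bar>f y - g y\<bar> \<le> r"
    "x \<in> unitI" "\<And>n. \<bar>(g ^^ n) x - w n\<bar> \<le> \<epsilon>"
proof -
  define \<sigma> where "\<sigma> = (r - \<rho>) / 2"
  have "\<sigma> > 0"
    using assms by (simp add: \<sigma>_def)
  have "uniformly_continuous_on unitI f"
    using f by (auto simp: self_map_I_def intro: compact_uniformly_continuous)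
  then obtain d where "d > 0"
    and d: "\<And>x y. x \<in> unitI \<Longrightarrow> y \<in> unitI \<Longrightarrow> \<bar>y - x\<bar> < d \<Longrightarrow> \<bar>f y - f x\<bar> < \<sigma>"
    using \<open>\<sigma> > 0\<close> unfolding uniformly_continuous_on_def dist_real_def by metis
  \<comment> \<open>The bound \<open>\<epsilon>\<close> is for the tracking, 1 lets a window fit
    into the unit interval, \<open>d\<close> limits the variation of \<open>f\<close> on a window to
    \<open>\<sigma>\<close>, and the other \<open>\<sigma>\<close> of the slack
    \<open>r - \<rho>\<close> absorbs the size of the next window.\<close>
  define l where "l = Min {\<epsilon>, 1, \<sigma>, d / 2}"
  have l: "0 < l" "l \<le> \<epsilon>" "l \<le> 1" "l \<le> \<sigma>" "l < d"
    using \<open>\<sigma> > 0\<close> \<open>d > 0\<close> \<open>0 < \<epsilon>\<close> by (auto simp: l_def min_less_iff_disj)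
  define g where "g = (\<lambda>y. clampI (ext_I f y + r * sin (2 * pi * y / l)))"
  have g_cont: "continuous_on UNIV g"
    unfolding g_def using continuous_on_ext_I[OF f] l by (intro continuous_intros) auto
  have g_self: "self_map_I g"
    unfolding self_map_I_def using g_cont by (auto simp: g_def intro: continuous_on_subset)
  have g_near: "\<bar>f y - g y\<bar> \<le> r" if "y \<in> unitI" for y
  proof -
    have "\<bar>g y - f y\<bar> \<le> \<bar>ext_I f y + r * sin (2 * pi * y / l) - f y\<bar>"
      unfolding g_def by (rule clampI_dist) (use ext_I_in[OF f, of y] that in \<open>simp add: ext_I_eq\<close>)
    also have "\<dots> = r * \<bar>sin (2 * pi * y / l)\<bar>"
      using that \<open>0 < r\<close> by (simp add: ext_I_eq abs_mult)
    also have "\<dots> \<le> r"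
      using \<open>0 < r\<close> by (simp add: mult_left_le)
    finally show ?thesis by simp
  qed
  \<comment> \<open>A window of length exactly one period of the sine, pushed to the left when
    \<open>w n\<close> is close to 1 so that it stays in the unit interval.\<close>
  define J where "J n = {min (w n) (1 - l)..min (w n) (1 - l) + l}" for n
  have w_J: "w n \<in> J n" and J_sub: "J n \<subseteq> unitI" for n
    using w_in[of n] l by (auto simp: J_def min_def)
  have J_near: "\<bar>y - w n\<bar> \<le> l" if "y \<in> J n" for y n
    using that w_in[of n] l by (auto simp: J_def min_def split: if_splits)
  have "J (Suc n) \<subseteq> g ` J n" for n
  proof
    fix y assume y: "y \<in> J (Suc n)"
    \<comment> \<open>At the crest \<open>x1\<close>, \<open>g\<close> is at least the minimum of 1
      and \<open>f (w n) - \<sigma> + r\<close>, which is \<open>f (w n) + \<rho> + \<sigma>\<close>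
      inside the minimum; the trough \<open>x2\<close> is symmetric. So \<open>y\<close> lies
      between the two values and connectedness applies.\<close>
    obtain x1 x2 where x: "x1 \<in> J n" "sin (2 * pi * x1 / l) = 1"
      "x2 \<in> J n" "sin (2 * pi * x2 / l) = -1"
      unfolding J_def using interval_contains_sin_extrema[OF l(1)] by metis
    have f_near: "\<bar>f z - f (w n)\<bar> < \<sigma>" if "z \<in> J n" for z
      using d[of "w n" z] J_near[OF that] l J_sub that w_in[of n] by fastforce
    have "y \<in> unitI" "\<bar>y - w (Suc n)\<bar> \<le> \<sigma>"
      using y J_sub J_near[OF y] l by (blast, linarith)
    moreover have "\<bar>y - f (w n)\<bar> \<le> \<rho> + \<sigma>"
      using \<open>\<bar>y - w (Suc n)\<bar> \<le> \<sigma>\<close> w_step[of n] by linarith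
    moreover have "\<rho> + 2 * \<sigma> = r"
      by (simp add: \<sigma>_def field_simps)
    ultimately have "g x2 \<le> y" "y \<le> g x1"
      using x f_near[OF x(1)] f_near[OF x(3)] J_sub[of n]
      by (auto simp: g_def ext_I_eq subset_iff max_def min_def)
    moreover have "connected (g ` J n)"
      by (intro connected_continuous_image continuous_on_subset[OF g_cont]) (auto simp: J_def)
    ultimately show "y \<in> g ` J n"
      using connected_contains_Icc[of "g ` J n" "g x2" "g x1"] x by auto
  qed
  moreover have "compact (J n)" "J n \<noteq> {}" for n
    using w_J[of n] by (auto simp: J_def)
  ultimately obtain x where x: "\<And>n. (g ^^ n) x \<in> J n"
    using itinerary_exists[OF g_cont] by metis
  have "x \<in> unitI"
    using x[of 0] J_sub by force
  moreover have "\<bar>(g ^^ n) x - w n\<bar> \<le> \<epsilon>" for n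
    using J_near[OF x[of n]] l by linarith
  ultimately show thesis
    using that[of g x] g_self g_near by blast
qed

section \<open>Almost periodicity of pseudo-orbits under stability\<close>

text \<open>Stability for one fixed pair of constants, which the quantitative lemmas can then
  share.\<close>

definition stable_at :: "(real \<Rightarrow> real) \<Rightarrow> real \<Rightarrow> real \<Rightarrow> bool" where
  "stable_at f \<epsilon> \<delta> \<longleftrightarrow>
    (\<forall>g. self_map_I g \<and> (SUP x\<in>unitI. \<bar>f x - g x\<bar>) < \<delta> \<longrightarrow>
       (\<forall>x\<in>unitI. \<exists>p\<in>Per g.
          limsup (\<lambda>n. ereal \<bar>(g ^^ n) x - (g ^^ n) p\<bar>) < ereal \<epsilon>))"

lemma stable_atE:
  assumes "stable_at f \<epsilon> \<delta>" "self_map_I g" "\<And>y. y \<in> unitI \<Longrightarrow> \<bar>f y - g y\<bar> \<le> r" "r < \<delta>"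
    "x \<in> unitI"
  obtains p where "p \<in> Per g" "\<forall>\<^sub>F n in sequentially. \<bar>(g ^^ n) x - (g ^^ n) p\<bar> < \<epsilon>"
proof -
  have "(SUP x\<in>unitI. \<bar>f x - g x\<bar>) \<le> r"
    using assms(3) by (intro cSUP_least) auto
  then obtain p where "p \<in> Per g" "limsup (\<lambda>n. ereal \<bar>(g ^^ n) x - (g ^^ n) p\<bar>) < ereal \<epsilon>"
    using assms unfolding stable_at_def by (meson le_less_trans)
  with that show thesis
    by (fastforce dest: Limsup_lessD)
qed

lemma funpow_add_period:
  assumes "(g ^^ N) p = p"
  shows "(g ^^ (n + m * N)) p = (g ^^ n) p"
proof (induction m)
  case (Suc m)
  have "(g ^^ (n + Suc m * N)) p = (g ^^ (n + m * N)) ((g ^^ N) p)"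
    by (metis add.assoc add.commute comp_apply funpow_add mult_Suc)
  then show ?case
    using Suc assms by simp
qed simp

text \<open>Some perturbation of size at most \<open>(\<rho> + \<delta>) / 2 < \<delta>\<close> has
  an orbit within \<open>\<epsilon> / 2\<close> of \<open>w\<close>, and stability ties this orbit
  to a periodic one of period \<open>N\<close>. Times differing by a multiple of \<open>N\<close>
  are compared through the latter, at cost
  \<open>\<epsilon> / 2 + \<epsilon> + \<epsilon> + \<epsilon> / 2\<close>.\<close>

lemma pseudo_orbit_almost_periodic:
  assumes "self_map_I f" "stable_at f \<epsilon> \<delta>" "0 \<le> \<rho>" "\<rho> < \<delta>" "0 < \<epsilon>"
    and "\<And>n. w n \<in> unitI" "\<And>n. \<bar>w (Suc n) - f (w n)\<bar> \<le> \<rho>"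
  obtains N where "N \<ge> 1" "\<And>m. \<forall>\<^sub>F n in sequentially. \<bar>w n - w (n + m * N)\<bar> < 3 * \<epsilon>"
proof -
  obtain g x where g: "self_map_I g" "\<And>y. y \<in> unitI \<Longrightarrow> \<bar>f y - g y\<bar> \<le> (\<rho> + \<delta>) / 2"
    "x \<in> unitI" and near: "\<And>n. \<bar>(g ^^ n) x - w n\<bar> \<le> \<epsilon> / 2"
    using pseudo_orbit_realized[where f = f and w = w and \<rho> = \<rho> and r = "(\<rho> + \<delta>) / 2" and \<epsilon> = "\<epsilon> / 2"] assms
    by auto
  obtain p where "p \<in> Per g"
    and ev: "\<forall>\<^sub>F n in sequentially. \<bar>(g ^^ n) x - (g ^^ n) p\<bar> < \<epsilon>"
    using stable_atE[OF assms(2) g(1,2) _ g(3)] assms(3,4) by auto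
  then obtain N where N: "N \<ge> 1" "(g ^^ N) p = p"
    unfolding Per_def by auto
  have "\<forall>\<^sub>F n in sequentially. \<bar>w n - w (n + m * N)\<bar> < 3 * \<epsilon>" for m
  proof -
    have "\<forall>\<^sub>F n in sequentially. \<bar>(g ^^ (n + m * N)) x - (g ^^ n) p\<bar> < \<epsilon>"
      using sequentially_offset[OF ev, of "m * N"] funpow_add_period[OF N(2)] by simp
    with ev show ?thesis
    proof eventually_elim
      case (elim n)
      then show ?case
        using near[of n] near[of "n + m * N"] by linarith
    qed
  qed
  with that N(1) show thesis by blast
qed

section \<open>Chains of pseudo-orbit steps\<close>

text \<open>Taken as a relation, so that its powers are pseudo-orbit segments of given length and
  its reflexive transitive closure is reachability.\<close>

definition pseudo_step :: "(real \<Rightarrow> real) \<Rightarrow> real \<Rightarrow> (real \<times> real) set" where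
  "pseudo_step f \<rho> = {(x, y). x \<in> unitI \<and> y \<in> unitI \<and> \<bar>y - f x\<bar> \<le> \<rho>}"

lemma relpow_mult_refl:
  assumes "(x, x) \<in> R ^^ m"
  shows "(x, x) \<in> R ^^ (m * k)"
  by (induction k) (use assms in \<open>auto simp: relpow_add\<close>)

text \<open>Time \<open>n\<close> of the walk is decoded as offset \<open>n mod Q\<close> in block
  \<open>n div Q\<close>; the end of each block is the start of the next.\<close>

lemma relpow_concat_walk:
  fixes c :: "nat \<Rightarrow> 'a"
  assumes "Q \<ge> 1" "\<And>n. (c n, c (Suc n)) \<in> R ^^ Q"
  obtains w where "\<And>n. (w n, w (Suc n)) \<in> R" "\<And>n. w (n * Q) = c n"
proof -
  have "\<forall>n. \<exists>h. h 0 = c n \<and> h Q = c (Suc n) \<and> (\<forall>i<Q. (h i, h (Suc i)) \<in> R)"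
    using assms(2) by (simp add: relpow_fun_conv)
  then obtain h where h: "\<And>n. h n 0 = c n" "\<And>n. h n Q = c (Suc n)"
    "\<And>n i. i < Q \<Longrightarrow> (h n i, h n (Suc i)) \<in> R"
    by metis
  define w where "w n = h (n div Q) (n mod Q)" for n
  have "w (Suc n) = h (n div Q) (Suc (n mod Q))" for n
    using h(1,2) by (auto simp: w_def div_Suc mod_Suc)
  then have "(w n, w (Suc n)) \<in> R" for n
    using h(3)[of "n mod Q" "n div Q"] assms(1) by (simp add: w_def)
  moreover have "w (n * Q) = c n" for n
    using h(1) assms(1) by (simp add: w_def)
  ultimately show thesis
    using that by blast
qed

text \<open>Since \<open>u\<close> and \<open>v\<close> both lie \<open>N\<close> steps after
  \<open>a\<close>, a pseudo-orbit passing through \<open>a\<close> can choose either one without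
  changing its timing. Almost periodicity limits this freedom only if the two points are
  close.\<close>

lemma equal_time_returning_points_close:
  assumes "self_map_I f" "stable_at f \<epsilon> \<delta>" "0 \<le> \<rho>" "\<rho> < \<delta>" "0 < \<epsilon>"
    and "N \<ge> 1" "(a, u) \<in> pseudo_step f \<rho> ^^ N" "(a, v) \<in> pseudo_step f \<rho> ^^ N"
    and "(u, a) \<in> (pseudo_step f \<rho>)\<^sup>*" "(v, a) \<in> (pseudo_step f \<rho>)\<^sup>*"
  shows "\<bar>u - v\<bar> < 3 * \<epsilon>"
proof -
  let ?R = "pseudo_step f \<rho>"
  obtain s t where st: "(u, a) \<in> ?R ^^ s" "(v, a) \<in> ?R ^^ t"
    using assms(9,10) by (meson rtrancl_imp_relpow)
  have walk: "(x, y) \<in> ?R ^^ (s + N)" "(x', y) \<in> ?R ^^ (t + N)"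
    if "x = u" "x' = v" "y \<in> {u, v}" for x x' y
    using that st assms(7,8) by (auto simp: relpow_add)
  define Q where "Q = (s + N) * (t + N)"
  have "Q \<ge> 1"
    using assms(6) by (simp add: Q_def)
  \<comment> \<open>A journey of length \<open>Q\<close> loops at its starting point and moves on to
    its target only in the last leg; the common multiple gives journeys from \<open>u\<close> and
    from \<open>v\<close> the same length.\<close>
  have Q1: "Q = (s + N) * (t + N - 1) + (s + N)" "Q = (t + N) * (s + N - 1) + (t + N)"
  proof -
    obtain N' where "N = Suc N'"
      using assms(6) by (cases N) auto
    then show "Q = (s + N) * (t + N - 1) + (s + N)" "Q = (t + N) * (s + N - 1) + (t + N)"
      by (simp_all add: Q_def algebra_simps)
  qed
  have "(u, y) \<in> ?R ^^ Q" if "y \<in> {u, v}" for y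
    using relpow_mult_refl[OF walk(1)[of u v u]] walk(1)[of u v y] that
    unfolding Q1(1) by (auto simp: relpow_add)
  moreover have "(v, y) \<in> ?R ^^ Q" if "y \<in> {u, v}" for y
    using relpow_mult_refl[OF walk(2)[of u v v]] walk(2)[of u v y] that
    unfolding Q1(2) by (auto simp: relpow_add)
  ultimately have Q: "(x, y) \<in> ?R ^^ Q" if "x \<in> {u, v}" "y \<in> {u, v}" for x y
    using that by blast
  \<comment> \<open>The gaps between powers of two grow, so this order of visits is not eventually
    periodic.\<close>
  define c where "c n = (if \<exists>k. n = 2 ^ k then u else v)" for n :: nat
  obtain w where w: "\<And>n. (w n, w (Suc n)) \<in> ?R" and wc: "\<And>n. w (n * Q) = c n"
    using relpow_concat_walk[OF \<open>Q \<ge> 1\<close>, of c ?R] Q by (auto simp: c_def)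
  \<comment> \<open>Almost periodicity is used with the multiple \<open>Q\<close> of the period
    \<open>P\<close>, so that the shift fits the spacing of the visits.\<close>
  obtain P where "P \<ge> 1"
    and ev: "\<forall>\<^sub>F n in sequentially. \<bar>w n - w (n + Q * P)\<bar> < 3 * \<epsilon>"
    using pseudo_orbit_almost_periodic[OF assms(1-5), of w] w unfolding pseudo_step_def by blast
  then obtain n0 where n0: "\<And>n. n \<ge> n0 \<Longrightarrow> \<bar>w n - w (n + Q * P)\<bar> < 3 * \<epsilon>"
    unfolding eventually_sequentially by blast
  \<comment> \<open>Large enough to pass the threshold \<open>n0\<close> and to put
    \<open>2 ^ k + P\<close> strictly between two consecutive powers of two.\<close>
  define k where "k = n0 + P"
  have k: "k < 2 ^ k" "n0 \<le> k" "P \<le> k"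
    by (simp_all add: k_def)
  have "n0 \<le> 2 ^ k * Q"
    using k \<open>Q \<ge> 1\<close> mult_le_mono[of "k" "2 ^ k" 1 Q] by linarith
  then have "\<bar>c (2 ^ k) - c (2 ^ k + P)\<bar> < 3 * \<epsilon>"
    using n0[of "2 ^ k * Q"] wc[of "2 ^ k"] wc[of "2 ^ k + P"] by (simp add: algebra_simps)
  moreover have "2 ^ k + P \<noteq> 2 ^ j" for j
  proof
    assume j: "2 ^ k + P = 2 ^ j"
    have "(2::nat) ^ k < 2 ^ j" "(2::nat) ^ j < 2 ^ Suc k"
      using j \<open>P \<ge> 1\<close> k unfolding power_Suc by (linarith+)
    then show False
      using power_less_imp_less_exp[of "2::nat"] by (metis not_less_eq one_less_numeral_iff semiring_norm(76))
  qed
  then have "c (2 ^ k + P) = v" "c (2 ^ k) = u"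
    by (auto simp: c_def)
  ultimately show ?thesis by simp
qed

section \<open>Deterministic tracking by a periodic orbit\<close>

text \<open>On a cycle whose \<open>N\<close>-th iterate is the identity, \<open>n\<close> steps
  back amount to \<open>n * N - n\<close> steps forward.\<close>

lemma Per_funpow_preimage:
  assumes "self_map_I f" "p \<in> Per f"
  obtains p' where "p' \<in> Per f" "(f ^^ n) p' = p"
proof -
  obtain N where N: "N \<ge> 1" "(f ^^ N) p = p"
    using assms(2) by (auto simp: Per_def)
  define p' where "p' = (f ^^ (n * N - n)) p"
  have "(f ^^ N) p' = p'"
    unfolding p'_def using N(2) by (metis add.commute comp_apply funpow_add)
  moreover have "p' \<in> unitI"
    unfolding p'_def using assms by (intro self_map_I_funpow_in) (auto simp: Per_def)
  moreover have "(f ^^ n) p' = (f ^^ (n + (n * N - n))) p"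
    by (simp add: p'_def funpow_add)
  moreover have "n + (n * N - n) = 0 + n * N"
    using N(1) by (cases N) auto
  ultimately show thesis
    using that[of p'] N(1) funpow_add_period[OF N(2), of 0 n] by (auto simp: Per_def)
qed

text \<open>The pathwise half of the argument: \<open>Y\<close> will be the clamped process and
  \<open>d\<close> the noise bound. The final \<open>4 * \<epsilon>\<close> is
  \<open>3 * \<epsilon>\<close> from \<open>Y\<close> to the orbit of an accumulation point
  \<open>a\<close>, plus \<open>\<epsilon>\<close> from that orbit to a periodic one.\<close>

lemma tracked_by_periodic_orbit:
  assumes f: "self_map_I f" and stab: "stable_at f \<epsilon> \<delta>" and "0 \<le> d" "d < \<delta>" "0 < \<epsilon>"
    and Y_in: "\<And>n. Y n \<in> unitI"
    and Y_step: "\<And>r. d < r \<Longrightarrow> \<forall>\<^sub>F n in sequentially. \<bar>Y (Suc n) - f (Y n)\<bar> < r"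
    and inv: "\<And>z. z \<in> unitI \<Longrightarrow> \<forall>s>0. \<exists>\<^sub>F n in sequentially. \<bar>Y n - z\<bar> < s \<Longrightarrow>
      \<forall>s>0. \<exists>\<^sub>F n in sequentially. \<bar>Y n - f z\<bar> < s"
  obtains p where "p \<in> Per f" "\<forall>\<^sub>F n in sequentially. \<bar>Y n - (f ^^ n) p\<bar> < 4 * \<epsilon>"
proof -
  define acc where "acc z \<longleftrightarrow> (\<forall>s>0. \<exists>\<^sub>F n in sequentially. \<bar>Y n - z\<bar> < s)" for z
  \<comment> \<open>\<open>\<rho>'\<close> bounds the late steps of \<open>Y\<close>; the surplus
    \<open>\<rho> - \<rho>'\<close> allows one end of a step to be moved onto an accumulation
    point.\<close>
  define \<rho> \<rho>' where "\<rho> = (d + \<delta>) / 2" and "\<rho>' = (d + \<rho>) / 2"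
  have \<rho>: "d < \<rho>'" "\<rho>' < \<rho>" "\<rho> < \<delta>" "0 \<le> \<rho>"
    using assms(3,4) by (auto simp: \<rho>_def \<rho>'_def field_simps)
  let ?R = "pseudo_step f \<rho>"
  obtain n1 where n1: "\<And>n. n \<ge> n1 \<Longrightarrow> \<bar>Y (Suc n) - f (Y n)\<bar> < \<rho>'"
    using Y_step[OF \<rho>(1)] unfolding eventually_sequentially by blast
  have f_in: "f x \<in> unitI" if "x \<in> unitI" for x
    using f that unfolding self_map_I_def by blast
  have YR: "(Y n, Y (Suc n)) \<in> ?R" if "n \<ge> n1" for n
    using n1[OF that] Y_in \<rho> by (auto simp: pseudo_step_def)
  have YRn: "(Y n, Y (n + j)) \<in> ?R ^^ j" if "n \<ge> n1" for n j
    using YR that by (intro relpow_fun_conv[THEN iffD2] exI[of _ "\<lambda>i. Y (n + i)"]) auto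
  obtain a where "a \<in> unitI" "acc a"
  proof -
    obtain a q where "a \<in> unitI" "strict_mono q" "(Y \<circ> q) \<longlonglongrightarrow> a"
      using compact_Icc[of "0::real" 1] Y_in unfolding compact_def by metis
    moreover have "\<exists>\<^sub>F n in sequentially. \<bar>Y n - a\<bar> < s" if "s > 0" for s
    proof -
      have "\<forall>\<^sub>F n in sequentially. \<bar>Y (q n) - a\<bar> < s"
        using tendstoD[OF \<open>(Y \<circ> q) \<longlonglongrightarrow> a\<close> that] by (simp add: dist_real_def)
      then have "\<exists>\<^sub>F n in sequentially. \<bar>Y (q n) - a\<bar> < s"
        by (simp add: eventually_frequently)
      then show ?thesis
        using \<open>strict_mono q\<close> unfolding frequently_sequentially
        by (meson order_trans seq_suble)
    qed
    ultimately show thesis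
      using that by (auto simp: acc_def)
  qed
  \<comment> \<open>The last step, which lands near \<open>a\<close>, is redirected to
    \<open>a\<close> itself; hence the visit is sought at time \<open>Suc n\<close> or
    later.\<close>
  have to_a: "(Y n, a) \<in> ?R\<^sup>*" if "n \<ge> n1" for n
  proof -
    have "\<exists>\<^sub>F n in sequentially. \<bar>Y n - a\<bar> < \<rho> - \<rho>'"
      using \<open>acc a\<close> \<rho> by (auto simp: acc_def)
    then obtain m' where "m' \<ge> Suc n" "\<bar>Y m' - a\<bar> < \<rho> - \<rho>'"
      unfolding frequently_sequentially by blast
    then obtain m where m: "m \<ge> n" "\<bar>Y (Suc m) - a\<bar> < \<rho> - \<rho>'"
      by (cases m') auto
    have "(Y m, a) \<in> ?R"
      using m n1[of m] that \<open>a \<in> unitI\<close> Y_in[of m] by (auto simp: pseudo_step_def)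
    moreover have "(Y n, Y m) \<in> ?R\<^sup>*"
      using YRn[OF that, of "m - n"] m relpow_imp_rtrancl by fastforce
    ultimately show ?thesis by simp
  qed
  \<comment> \<open>When \<open>Y n\<close> is near \<open>z\<close>, continuity of \<open>f\<close>
    lets \<open>z\<close> replace \<open>Y n\<close> as the start of the step to
    \<open>Y (Suc n)\<close>.\<close>
  have from_acc: "\<exists>n\<ge>n1. (z, Y (Suc n)) \<in> ?R" if "z \<in> unitI" "acc z" for z
  proof -
    have "continuous_on unitI f"
      using f by (simp add: self_map_I_def)
    then obtain s where "s > 0"
      and s: "\<And>x. x \<in> unitI \<Longrightarrow> \<bar>x - z\<bar> < s \<Longrightarrow> \<bar>f x - f z\<bar> < \<rho> - \<rho>'"
      using \<open>z \<in> unitI\<close> \<rho> unfolding continuous_on_iff dist_real_def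
      by (metis diff_gt_0_iff_gt)
    have "\<exists>\<^sub>F n in sequentially. \<bar>Y n - z\<bar> < s"
      using \<open>acc z\<close> \<open>s > 0\<close> by (auto simp: acc_def)
    then obtain n where n: "n \<ge> n1" "\<bar>Y n - z\<bar> < s"
      unfolding frequently_sequentially by blast
    then have "\<bar>Y (Suc n) - f z\<bar> \<le> \<rho>"
      using s[OF Y_in n(2)] n1[OF n(1)] by linarith
    with n that Y_in show ?thesis
      by (auto simp: pseudo_step_def intro!: exI[of _ n])
  qed
  have orbit: "(f ^^ j) a \<in> unitI \<and> acc ((f ^^ j) a)" for j
    by (induction j) (use \<open>a \<in> unitI\<close> \<open>acc a\<close> f_in inv in \<open>auto simp: acc_def\<close>)
  obtain n2 where n2: "n2 \<ge> n1" "(a, Y (Suc n2)) \<in> ?R"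
    using from_acc[OF \<open>a \<in> unitI\<close> \<open>acc a\<close>] by blast
  \<comment> \<open>Here \<open>a\<close> stands in for \<open>Y n2\<close>, so both points are
    reached from \<open>a\<close> in \<open>j\<close> steps; both lead back to \<open>a\<close>, one
    along \<open>Y\<close>, the other by joining \<open>Y\<close> first.\<close>
  have close: "\<bar>Y (n2 + j) - (f ^^ j) a\<bar> < 3 * \<epsilon>" if "j \<ge> 1" for j
  proof (rule equal_time_returning_points_close[OF f stab \<rho>(4,3) \<open>0 < \<epsilon>\<close> that])
    obtain i where "j = Suc i"
      using \<open>j \<ge> 1\<close> by (cases j) auto
    then show "(a, Y (n2 + j)) \<in> ?R ^^ j"
      using n2 YRn[of "Suc n2" i] relpow_Suc_I2 by fastforce
    show "(a, (f ^^ j) a) \<in> ?R ^^ j"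
      using orbit \<rho> orbit[of "Suc _"]
      by (intro relpow_fun_conv[THEN iffD2] exI[of _ "\<lambda>i. (f ^^ i) a"]) (fastforce simp: pseudo_step_def)
    show "(Y (n2 + j), a) \<in> ?R\<^sup>*"
      using to_a n2 by simp
    obtain n where "n \<ge> n1" "((f ^^ j) a, Y (Suc n)) \<in> ?R"
      using from_acc orbit by blast
    then show "((f ^^ j) a, a) \<in> ?R\<^sup>*"
      using to_a[of "Suc n"] by (meson converse_rtrancl_into_rtrancl le_SucI)
  qed
  obtain p0 where p0: "p0 \<in> Per f" "\<forall>\<^sub>F n in sequentially. \<bar>(f ^^ n) a - (f ^^ n) p0\<bar> < \<epsilon>"
    using stable_atE[OF stab f, of 0 a] \<open>a \<in> unitI\<close> assms(3,4) by auto
  \<comment> \<open>The orbit of \<open>a\<close> was started at time \<open>n2\<close>, so the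
    periodic point is moved back by \<open>n2\<close> steps on its cycle.\<close>
  obtain p where p: "p \<in> Per f" "(f ^^ n2) p = p0"
    using Per_funpow_preimage[OF f p0(1)] by blast
  have "\<forall>\<^sub>F j in sequentially. \<bar>Y (j + n2) - (f ^^ (j + n2)) p\<bar> < 4 * \<epsilon>"
    using p0(2) eventually_ge_at_top[of 1]
  proof eventually_elim
    case (elim j)
    then show ?case
      using close[of j] p(2) by (simp add: funpow_add add.commute)
  qed
  then show thesis
    using that[OF p(1)] eventually_sequentially_seg[of "\<lambda>n. \<bar>Y n - (f ^^ n) p\<bar> < 4 * \<epsilon>" n2] by simp
qed

section \<open>Recurrent visits and fresh independent noise\<close>

text \<open>A second Borel--Cantelli argument along an adapted sequence of events \<open>A n\<close>: the weights \<open>W\<close>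
  below gain the factor \<open>c > 1\<close> at each visit to \<open>A n\<close> and vanish once \<open>E\<close> occurs at a visit. They form
  a supermartingale, so by Fatou they almost surely do not tend to infinity.\<close>

lemma (in prob_space) frequently_adapted_independent:
  fixes \<xi> :: "nat \<Rightarrow> 'a \<Rightarrow> 'b" and A :: "nat \<Rightarrow> (nat \<Rightarrow> 'b) set"
  assumes indep: "indep_vars (\<lambda>_. S) \<xi> UNIV"
    and A[measurable]: "\<And>n. A n \<in> sets (PiM {..<n} (\<lambda>_. S))"
    and E[measurable]: "E \<in> sets S"
    and "0 < p" and p: "\<And>n. p \<le> prob {\<omega> \<in> space M. \<xi> n \<omega> \<in> E}"
  shows "AE \<omega> in M. (\<exists>\<^sub>F n in sequentially. (\<lambda>i\<in>{..<n}. \<xi> i \<omega>) \<in> A n) \<longrightarrow>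
    (\<exists>\<^sub>F n in sequentially. (\<lambda>i\<in>{..<n}. \<xi> i \<omega>) \<in> A n \<and> \<xi> n \<omega> \<in> E)"
proof -
  have \<xi>[measurable]: "\<xi> n \<in> measurable M S" for n
    using indep by (simp add: indep_vars_def)
  have past[measurable]: "(\<lambda>\<omega>. \<lambda>i\<in>{..<n}. \<xi> i \<omega>) \<in> measurable M (PiM {..<n} (\<lambda>_. S))" for n
    by (intro measurable_restrict) simp
  have "p \<le> 1"
    using p[of 0] prob_le_1 order_trans by blast
  \<comment> \<open>What matters is \<open>c > 1\<close> and \<open>c * (1 - p) \<le> 1\<close>: the
    gain at a visit is offset by the chance of at least \<open>p\<close> of dropping to 0.\<close>
  define c where "c = 1 / (1 - p / 2)"
  have c: "c > 1" "c * (1 - p) \<le> 1"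
    using \<open>0 < p\<close> \<open>p \<le> 1\<close> by (auto simp: c_def field_simps)
  define h where "h n v = (if restrict v {..<n} \<in> A n then (if v n \<in> E then 0 else c) else 1)"
    for n and v :: "nat \<Rightarrow> 'b"
  have h_nonneg: "0 \<le> h n v" for n v
    using c by (simp add: h_def)
  have h_le: "h n v \<le> c" for n v
    using c by (simp add: h_def)
  have h_meas: "h i \<in> borel_measurable (PiM {..<n} (\<lambda>_. S))" if "i < n" for i n
  proof -
    have [measurable]: "(\<lambda>v. restrict v {..<i}) \<in> measurable (PiM {..<n} (\<lambda>_. S)) (PiM {..<i} (\<lambda>_. S))"
      using that by (intro measurable_restrict_subset) auto
    have [measurable]: "(\<lambda>v. v i) \<in> measurable (PiM {..<n} (\<lambda>_. S)) S"
      using that by (intro measurable_component_singleton) auto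
    show ?thesis
      unfolding h_def by measurable
  qed
  \<comment> \<open>With a countable union over \<open>N\<close> in view, it suffices to exclude
    endless visits at which \<open>E\<close> fails from time \<open>N\<close> on. The weights
    therefore start at \<open>N\<close>.\<close>
  have escape: "AE \<omega> in M. \<not> ((\<exists>\<^sub>F n in sequentially. (\<lambda>i\<in>{..<n}. \<xi> i \<omega>) \<in> A n) \<and>
    (\<forall>n\<ge>N. (\<lambda>i\<in>{..<n}. \<xi> i \<omega>) \<in> A n \<longrightarrow> \<xi> n \<omega> \<notin> E))" for N
  proof -
    define w where "w n v = (\<Prod>i\<in>{N..<n}. h i v)" for n v
    have w_nonneg: "0 \<le> w n v" for n v
      unfolding w_def using h_nonneg by (intro prod_nonneg) auto
    have w_le: "w n v \<le> c ^ (n - N)" for n v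
      unfolding w_def using h_nonneg h_le prod_mono[of "{N..<n}" "\<lambda>i. h i v" "\<lambda>_. c"] by simp
    have w_meas[measurable]: "w n \<in> borel_measurable (PiM {..<n} (\<lambda>_. S))" for n
      unfolding w_def[abs_def] using h_meas by (intro borel_measurable_prod) auto
    \<comment> \<open>This form exhibits the weight as a function of the first \<open>n\<close>
      noises, as measurability and independence require; \<open>W_alt\<close> gives the
      recursion.\<close>
    define W where "W n \<omega> = w n (\<lambda>i\<in>{..<n}. \<xi> i \<omega>)" for n \<omega>
    have W_alt: "W n \<omega> = (\<Prod>i\<in>{N..<n}. h i (\<lambda>i. \<xi> i \<omega>))" for n \<omega>
    proof -
      have "restrict (restrict (\<lambda>i. \<xi> i \<omega>) {..<n}) {..<i} = restrict (\<lambda>i. \<xi> i \<omega>) {..<i}"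
        if "i < n" for i
        using that by (auto simp: restrict_def)
      then show ?thesis
        unfolding W_def w_def by (intro prod.cong) (auto simp: h_def)
    qed
    have [measurable]: "W n \<in> borel_measurable M" for n
      unfolding W_def[abs_def] by measurable
    have int_past: "integrable M (\<lambda>\<omega>. w n (\<lambda>i\<in>{..<n}. \<xi> i \<omega>) * indicator B (\<lambda>i\<in>{..<n}. \<xi> i \<omega>) :: real)"
      if [measurable]: "B \<in> sets (PiM {..<n} (\<lambda>_. S))" for n B
      using w_le w_nonneg c
      by (intro integrable_const_bound[of _ "c ^ (n - N)"]) (auto simp: indicator_def)
    have int_W: "integrable M (W n)" for n
      unfolding W_def using w_le w_nonneg c
      by (intro integrable_const_bound[of _ "c ^ (n - N)"]) auto
    have super: "expectation (W (Suc n)) \<le> expectation (W n)" if "n \<ge> N" for n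
    proof -
      \<comment> \<open>On \<open>B\<close> the weight is kept; on \<open>A n\<close> it survives,
        multiplied by \<open>c\<close>, only if \<open>E\<close> fails, and this failure is
        independent of the past.\<close>
      define B where "B = space (PiM {..<n} (\<lambda>_. S)) - A n"
      have [measurable]: "B \<in> sets (PiM {..<n} (\<lambda>_. S))"
        unfolding B_def by measurable
      let ?past = "\<lambda>\<omega>. \<lambda>i\<in>{..<n}. \<xi> i \<omega>"
      let ?WA = "\<lambda>\<omega>. w n (?past \<omega>) * indicator (A n) (?past \<omega>)"
      let ?WB = "\<lambda>\<omega>. w n (?past \<omega>) * indicator B (?past \<omega>)"
      let ?E = "\<lambda>\<omega>. indicator (space S - E) (\<xi> n \<omega>) :: real"
      have past_space: "?past \<omega> \<in> space (PiM {..<n} (\<lambda>_. S))" "\<xi> n \<omega> \<in> space S"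
        if "\<omega> \<in> space M" for \<omega>
        using measurable_space[OF past that] measurable_space[OF \<xi> that] by auto
      have "W (Suc n) \<omega> = ?WB \<omega> + c * (?WA \<omega> * ?E \<omega>)" if "\<omega> \<in> space M" for \<omega>
      proof -
        have "W (Suc n) \<omega> = W n \<omega> * h n (\<lambda>i. \<xi> i \<omega>)"
          using \<open>n \<ge> N\<close> by (simp add: W_alt)
        then show ?thesis
          using past_space[OF that] by (simp add: W_def h_def B_def indicator_def)
      qed
      then have "expectation (W (Suc n)) = expectation (\<lambda>\<omega>. ?WB \<omega> + c * (?WA \<omega> * ?E \<omega>))"
        by (intro Bochner_Integration.integral_cong) auto
      moreover have ind: "indep_var borel ?WA borel ?E"
      proof -
        have "indep_var (PiM {..<n} (\<lambda>_. S)) ?past (PiM {n} (\<lambda>_. S)) (\<lambda>\<omega>. \<lambda>i\<in>{n}. \<xi> i \<omega>)"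
          by (intro indep_var_restrict[OF indep]) auto
        from indep_var_compose[OF this, of "\<lambda>v. w n v * indicator (A n) v" borel
            "\<lambda>v. indicator (space S - E) (v n)" borel]
        show ?thesis
          by (simp add: comp_def)
      qed
      moreover have int_E: "integrable M ?E"
        by (intro integrable_const_bound[of _ 1]) (auto simp: indicator_def)
      ultimately have "expectation (W (Suc n)) = expectation ?WB + c * (expectation ?WA * expectation ?E)"
        using int_past[of B n] int_past[of "A n" n] indep_var_integrable[OF ind]
        by (simp add: indep_var_lebesgue_integral[OF ind])
      moreover have "expectation ?E \<le> 1 - p"
      proof -
        have "expectation ?E = expectation (indicator (space M - {\<omega> \<in> space M. \<xi> n \<omega> \<in> E}))"
          using past_space by (intro Bochner_Integration.integral_cong) (auto simp: indicator_def)
        also have "\<dots> = 1 - prob {\<omega> \<in> space M. \<xi> n \<omega> \<in> E}"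
          by (simp add: prob_compl)
        finally show ?thesis
          using p[of n] by simp
      qed
      moreover have "0 \<le> expectation ?WA"
        using w_nonneg by (intro Bochner_Integration.integral_nonneg) simp
      ultimately have "expectation (W (Suc n)) \<le> expectation ?WB + (c * (1 - p)) * expectation ?WA"
        using c mult_left_mono[of "expectation ?E" "1 - p" "c * expectation ?WA"]
        by (simp add: algebra_simps)
      also have "\<dots> \<le> expectation ?WB + expectation ?WA"
        using c(2) \<open>0 \<le> expectation ?WA\<close> mult_right_mono by fastforce
      also have "\<dots> = expectation (\<lambda>\<omega>. ?WB \<omega> + ?WA \<omega>)"
        using int_past[of B n] int_past[of "A n" n] by simp
      also have "\<dots> = expectation (W n)"
        using past_space
        by (intro Bochner_Integration.integral_cong) (auto simp: W_def B_def indicator_def)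
      finally show ?thesis .
    qed
    have "expectation (W n) \<le> 1" for n
    proof (induction n)
      case 0
      then show ?case by (simp add: W_def w_def prob_space)
    next
      case (Suc n)
      show ?case
      proof (cases "n \<ge> N")
        case True
        with super Suc show ?thesis by (meson order_trans)
      next
        case False
        then show ?thesis by (simp add: W_def w_def prob_space)
      qed
    qed
    then have nn: "(\<integral>\<^sup>+\<omega>. ennreal (W n \<omega>) \<partial>M) \<le> 1" for n
      using w_nonneg by (subst nn_integral_eq_integral[OF int_W]) (auto simp: W_def)
    have "(\<integral>\<^sup>+\<omega>. liminf (\<lambda>n. ennreal (W n \<omega>)) \<partial>M) \<le> liminf (\<lambda>n. \<integral>\<^sup>+\<omega>. ennreal (W n \<omega>) \<partial>M)"
      by (intro nn_integral_liminf) auto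
    also have "\<dots> \<le> limsup (\<lambda>n. \<integral>\<^sup>+\<omega>. ennreal (W n \<omega>) \<partial>M)"
      by (intro Liminf_le_Limsup) simp
    also have "\<dots> \<le> 1"
      using nn by (intro Limsup_bounded) auto
    finally have "AE \<omega> in M. liminf (\<lambda>n. ennreal (W n \<omega>)) \<noteq> \<infinity>"
      by (intro nn_integral_PInf_AE) (auto simp: top_unique)
    then show ?thesis
    proof eventually_elim
      case (elim \<omega>)
      show ?case
      proof
        assume bad: "(\<exists>\<^sub>F n in sequentially. (\<lambda>i\<in>{..<n}. \<xi> i \<omega>) \<in> A n) \<and>
          (\<forall>n\<ge>N. (\<lambda>i\<in>{..<n}. \<xi> i \<omega>) \<in> A n \<longrightarrow> \<xi> n \<omega> \<notin> E)"
        \<comment> \<open>On the bad event no visit kills the weight: from time \<open>N\<close> on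
          it never decreases and gains the factor \<open>c\<close> infinitely often.\<close>
        have W_step: "W (Suc n) \<omega> = W n \<omega> * (if (\<lambda>i\<in>{..<n}. \<xi> i \<omega>) \<in> A n then c else 1)" if "n \<ge> N" for n
          using that bad by (simp add: W_alt h_def)
        have mono: "W m \<omega> \<le> W n \<omega>" if "N \<le> m" "m \<le> n" for m n
          using that(2)
        proof (induction n rule: dec_induct)
          case (step n)
          have "W n \<omega> \<le> W (Suc n) \<omega>"
            using W_step[of n] step.hyps that(1) c w_nonneg mult_left_mono[of 1 c "W n \<omega>"]
            by (auto simp: W_def)
          with step show ?case by simp
        qed simp
        have grow: "\<exists>m\<ge>N. c ^ j \<le> W m \<omega>" for j
        proof (induction j)
          case 0
          then show ?case by (intro exI[of _ N]) (simp add: W_alt)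
        next
          case (Suc j)
          then obtain m where m: "m \<ge> N" "c ^ j \<le> W m \<omega>"
            by blast
          obtain n where n: "n \<ge> m" "(\<lambda>i\<in>{..<n}. \<xi> i \<omega>) \<in> A n"
            using bad unfolding frequently_sequentially by blast
          have "c ^ Suc j \<le> W (Suc n) \<omega>"
            using m n c mono[of m n] W_step[of n] mult_right_mono[of "c ^ j" "W n \<omega>" c] by simp
          with m n show ?case
            by (intro exI[of _ "Suc n"]) simp
        qed
        have "filterlim (\<lambda>n. W n \<omega>) at_top sequentially"
          unfolding filterlim_at_top
        proof
          fix Z :: real
          obtain j where "Z < c ^ j"
            using real_arch_pow c(1) by blast
          then obtain m where "m \<ge> N" "Z \<le> W m \<omega>"
            using grow[of j] by force
          then show "\<forall>\<^sub>F n in sequentially. Z \<le> W n \<omega>"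
            using mono unfolding eventually_sequentially by (meson order_trans)
        qed
        then have "(\<lambda>n. ennreal (W n \<omega>)) \<longlonglongrightarrow> \<infinity>"
          by (simp add: ennreal_tendsto_top_eq_at_top)
        then show False
          using elim lim_imp_Liminf[of sequentially] by force
      qed
    qed
  qed
  have "AE \<omega> in M. \<forall>N. \<not> ((\<exists>\<^sub>F n in sequentially. (\<lambda>i\<in>{..<n}. \<xi> i \<omega>) \<in> A n) \<and>
    (\<forall>n\<ge>N. (\<lambda>i\<in>{..<n}. \<xi> i \<omega>) \<in> A n \<longrightarrow> \<xi> n \<omega> \<notin> E))"
    using escape unfolding AE_all_countable by blast
  then show ?thesis
    by eventually_elim (auto simp: frequently_def eventually_sequentially)
qed

section \<open>Uniform noise and accumulation points of the process\<close>

lemma uniform_noise_measurable: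
  assumes "prob_space M" "uniform_noise M \<delta> \<xi>"
  shows "\<xi> n \<in> borel_measurable M"
  using assms unfolding uniform_noise_def by (simp add: prob_space.indep_vars_def)

lemma uniform_noise_bounded:
  assumes "prob_space M" "uniform_noise M \<delta> \<xi>" "0 < \<delta>"
  shows "AE \<omega> in M. \<bar>\<xi> n \<omega>\<bar> \<le> \<delta>"
proof -
  have [measurable]: "\<xi> n \<in> borel_measurable M"
    using uniform_noise_measurable[OF assms(1,2)] .
  have "AE x in uniform_measure lborel {-\<delta>..\<delta>}. \<bar>x\<bar> \<le> \<delta>"
    by (intro AE_uniform_measureI) auto
  moreover have "distr M lborel (\<xi> n) = uniform_measure lborel {-\<delta>..\<delta>}"
    using assms(2) by (simp add: uniform_noise_def)
  ultimately have "AE x in distr M lborel (\<xi> n). \<bar>x\<bar> \<le> \<delta>"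
    by metis
  then show ?thesis
    by (subst (asm) AE_distr_iff) auto
qed

text \<open>All noises have the same law, so one bound serves every \<open>n\<close>. Cutting
  \<open>s\<close> down to \<open>min s \<delta>\<close> puts the interval inside the support, where
  its probability is \<open>t / \<delta>\<close>.\<close>

lemma uniform_noise_small:
  assumes "prob_space M" "uniform_noise M \<delta> \<xi>" "0 < \<delta>" "0 < s"
  obtains p where "0 < p" "\<And>n. p \<le> measure M {\<omega> \<in> space M. \<xi> n \<omega> \<in> {-s<..<s}}"
proof -
  let ?U = "uniform_measure lborel {-\<delta>..\<delta>}"
  have [measurable]: "\<xi> n \<in> borel_measurable M" for n
    using uniform_noise_measurable[OF assms(1,2)] .
  have "measure M {\<omega> \<in> space M. \<xi> n \<omega> \<in> {-s<..<s}} = measure (distr M lborel (\<xi> n)) {-s<..<s}" for n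
    by (subst measure_distr) (auto intro!: arg_cong[where f = "measure M"])
  then have eq: "measure M {\<omega> \<in> space M. \<xi> n \<omega> \<in> {-s<..<s}} = measure ?U {-s<..<s}" for n
    using assms(2) by (simp add: uniform_noise_def)
  define t where "t = min s \<delta>"
  have "0 < t"
    using assms by (simp add: t_def)
  have "measure ?U {-s<..<s} \<ge> measure ?U {-t<..<t}"
  proof -
    interpret U: prob_space ?U
      using assms(3) by (intro prob_space_uniform_measure) auto
    show ?thesis
      by (intro U.finite_measure_mono) (auto simp: t_def)
  qed
  moreover have "measure ?U {-t<..<t} = t / \<delta>"
  proof -
    have "{-\<delta>..\<delta>} \<inter> {-t<..<t} = {-t<..<t}"
      by (auto simp: t_def)
    then show ?thesis
      using assms(3) \<open>0 < t\<close> by (subst measure_uniform_measure) auto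
  qed
  ultimately show thesis
    using that[of "t / \<delta>"] eq \<open>0 < t\<close> assms(3) by simp
qed

text \<open>With coordinate projections as noise the process becomes a function on sequences, so
  events about it can be written as sets in the product space of past noises.\<close>

lemma rproc_restrict:
  assumes "m \<le> n"
  shows "rproc gs (\<lambda>i v. v i) x0 m (\<lambda>i\<in>{..<n}. \<xi> i \<omega>) = rproc gs \<xi> x0 m \<omega>"
  using assms by (induction m) auto

lemma rproc_measurable_past:
  assumes "\<And>n. self_map_I (gs n)" "m \<le> n"
  shows "rproc gs (\<lambda>i v. v i) x0 m \<in> borel_measurable (PiM {..<n} (\<lambda>_. borel))"
  using assms(2)
proof (induction m)
  case 0
  then show ?case
    by (simp add: rproc.simps(1)[abs_def])
next
  case (Suc m)
  have [measurable]: "ext_I (gs m) \<in> borel_measurable borel"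
    using continuous_on_ext_I[OF assms(1)] by (rule borel_measurable_continuous_onI)
  have [measurable]: "(\<lambda>v. v m) \<in> borel_measurable (PiM {..<n} (\<lambda>_. borel))"
    using Suc.prems by (intro measurable_component_singleton) auto
  have [measurable]: "rproc gs (\<lambda>i v. v i) x0 m \<in> borel_measurable (PiM {..<n} (\<lambda>_. borel))"
    using Suc by simp
  show ?case
    unfolding rproc.simps by measurable
qed

text \<open>A visit at time \<open>n\<close> is decided by the noises before \<open>n\<close>,
  whereas \<open>\<xi> n\<close> is independent of them and small with probability bounded
  below.\<close>

lemma rproc_visits_with_small_noise:
  assumes "prob_space M" "uniform_noise M \<delta> \<xi>" "0 < \<delta>" "\<And>n. self_map_I (gs n)" "0 < s"
  shows "AE \<omega> in M. (\<exists>\<^sub>F n in sequentially. \<bar>clampI (rproc gs \<xi> x0 n \<omega>) - q\<bar> < t) \<longrightarrow>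
    (\<exists>\<^sub>F n in sequentially. \<bar>clampI (rproc gs \<xi> x0 n \<omega>) - q\<bar> < t \<and> \<bar>\<xi> n \<omega>\<bar> < s)"
proof -
  interpret prob_space M by fact
  define A where "A n = {v \<in> space (PiM {..<n} (\<lambda>_. borel)).
    \<bar>clampI (rproc gs (\<lambda>i v. v i) x0 n v) - q\<bar> < t}" for n
  have [measurable]: "rproc gs (\<lambda>i v. v i) x0 n \<in> borel_measurable (PiM {..<n} (\<lambda>_. borel))" for n
    by (rule rproc_measurable_past[OF assms(4)]) simp
  have "A n \<in> sets (PiM {..<n} (\<lambda>_. borel))" for n
    unfolding A_def by measurable
  moreover obtain p where "0 < p" "\<And>n. p \<le> prob {\<omega> \<in> space M. \<xi> n \<omega> \<in> {-s<..<s}}"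
    using uniform_noise_small[OF assms(1-3,5)] by metis
  moreover have "indep_vars (\<lambda>_. borel) \<xi> UNIV"
    using assms(2) by (simp add: uniform_noise_def)
  ultimately have *: "AE \<omega> in M. (\<exists>\<^sub>F n in sequentially. (\<lambda>i\<in>{..<n}. \<xi> i \<omega>) \<in> A n) \<longrightarrow>
    (\<exists>\<^sub>F n in sequentially. (\<lambda>i\<in>{..<n}. \<xi> i \<omega>) \<in> A n \<and> \<xi> n \<omega> \<in> {-s<..<s})"
    by (intro frequently_adapted_independent) auto
  have A_iff: "(\<lambda>i\<in>{..<n}. \<xi> i \<omega>) \<in> A n \<longleftrightarrow> \<bar>clampI (rproc gs \<xi> x0 n \<omega>) - q\<bar> < t" for n \<omega>
    by (simp add: A_def rproc_restrict space_PiM)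
  have small_iff: "\<xi> n \<omega> \<in> {-s<..<s} \<longleftrightarrow> \<bar>\<xi> n \<omega>\<bar> < s" for n \<omega>
    by auto
  show ?thesis
    using * unfolding A_iff small_iff .
qed

lemma rproc_clamp_step:
  assumes "\<bar>gs n (clampI (rproc gs \<xi> x0 n \<omega>)) - f (clampI (rproc gs \<xi> x0 n \<omega>))\<bar> < e"
    and "z \<in> unitI"
  shows "\<bar>clampI (rproc gs \<xi> x0 (Suc n) \<omega>) - z\<bar> < e + \<bar>\<xi> n \<omega>\<bar> + \<bar>f (clampI (rproc gs \<xi> x0 n \<omega>)) - z\<bar>"
proof -
  define y where "y = clampI (rproc gs \<xi> x0 n \<omega>)"
  have "\<bar>gs n y + \<xi> n \<omega> - z\<bar> < e + \<bar>\<xi> n \<omega>\<bar> + \<bar>f y - z\<bar>"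
    using assms(1) unfolding y_def[symmetric] by linarith
  moreover have "rproc gs \<xi> x0 (Suc n) \<omega> = gs n y + \<xi> n \<omega>"
    by (simp add: ext_I_def y_def)
  ultimately show ?thesis
    unfolding y_def[symmetric] by (metis clampI_dist[OF assms(2)] order_le_less_trans)
qed

text \<open>Late visits near \<open>z\<close> with small noise are followed by positions near
  \<open>f z\<close>, because the maps converge uniformly to the continuous
  \<open>f\<close>.\<close>

lemma rproc_accumulation_invariant:
  assumes "prob_space M" "uniform_noise M \<delta> \<xi>" "0 < \<delta>" "\<And>n. self_map_I (gs n)" "self_map_I f"
    and lim: "uniform_limit unitI gs f sequentially"
  shows "AE \<omega> in M. \<forall>z\<in>unitI.
    (\<forall>s>0. \<exists>\<^sub>F n in sequentially. \<bar>clampI (rproc gs \<xi> x0 n \<omega>) - z\<bar> < s) \<longrightarrow>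
    (\<forall>s>0. \<exists>\<^sub>F n in sequentially. \<bar>clampI (rproc gs \<xi> x0 n \<omega>) - f z\<bar> < s)"
proof -
  \<comment> \<open>Rational centres and reciprocal radii leave countably many null sets, so one
    exceptional set serves all \<open>z\<close>.\<close>
  have "AE \<omega> in M. \<forall>q i j.
    (\<exists>\<^sub>F n in sequentially. \<bar>clampI (rproc gs \<xi> x0 n \<omega>) - of_rat q\<bar> < inverse (real (Suc i))) \<longrightarrow>
    (\<exists>\<^sub>F n in sequentially. \<bar>clampI (rproc gs \<xi> x0 n \<omega>) - of_rat q\<bar> < inverse (real (Suc i)) \<and>
      \<bar>\<xi> n \<omega>\<bar> < inverse (real (Suc j)))"
    unfolding AE_all_countable
    by (intro allI rproc_visits_with_small_noise[OF assms(1-4)]) simp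
  then show ?thesis
  proof eventually_elim
    case (elim \<omega>)
    define Y where "Y n = clampI (rproc gs \<xi> x0 n \<omega>)" for n
    have Y_in: "Y n \<in> unitI" for n
      by (simp add: Y_def)
    have visits: "\<exists>\<^sub>F n in sequentially. \<bar>Y n - of_rat q\<bar> < inverse (real (Suc i)) \<and>
        \<bar>\<xi> n \<omega>\<bar> < inverse (real (Suc j))"
      if "\<exists>\<^sub>F n in sequentially. \<bar>Y n - of_rat q\<bar> < inverse (real (Suc i))" for q i j
      using elim that unfolding Y_def by blast
    have "\<exists>\<^sub>F n in sequentially. \<bar>Y n - f z\<bar> < s"
      if z: "z \<in> unitI" and acc: "\<And>s. s > 0 \<Longrightarrow> \<exists>\<^sub>F n in sequentially. \<bar>Y n - z\<bar> < s" and "s > 0" for z s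
    proof -
      have "f z \<in> unitI" "continuous_on unitI f"
        using assms(5) z unfolding self_map_I_def by blast+
      then obtain r where "r > 0" and r: "\<And>y. y \<in> unitI \<Longrightarrow> \<bar>y - z\<bar> < r \<Longrightarrow> \<bar>f y - f z\<bar> < s / 3"
        using z \<open>s > 0\<close> unfolding continuous_on_iff dist_real_def
        by (metis divide_pos_pos zero_less_numeral)
      obtain i where i: "inverse (real (Suc i)) < r / 2"
        using reals_Archimedean[of "r / 2"] \<open>r > 0\<close> by auto
      define t where "t = inverse (real (Suc i))"
      have "t > 0" by (simp add: t_def)
      \<comment> \<open>The ball of radius \<open>t\<close> around \<open>q\<close> contains the
        ball of radius \<open>t / 2\<close> around \<open>z\<close> and lies within \<open>r\<close>
        of \<open>z\<close>, since \<open>t < r / 2\<close>.\<close>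
      obtain q where "z - t / 2 < of_rat q" "of_rat q < z + t / 2"
        using of_rat_dense[of "z - t / 2" "z + t / 2"] \<open>t > 0\<close> by auto
      then have q: "\<bar>z - of_rat q\<bar> < t / 2"
        by linarith
      obtain j where j: "inverse (real (Suc j)) < s / 3"
        using reals_Archimedean[of "s / 3"] \<open>s > 0\<close> by auto
      have "\<exists>\<^sub>F n in sequentially. \<bar>Y n - of_rat q\<bar> < t"
      proof (rule frequently_elim1[OF acc[of "t / 2"]])
        show "\<bar>Y n - of_rat q\<bar> < t" if "\<bar>Y n - z\<bar> < t / 2" for n
          using that q by linarith
      qed (use \<open>t > 0\<close> in simp)
      then have "\<exists>\<^sub>F n in sequentially. \<bar>Y n - of_rat q\<bar> < t \<and> \<bar>\<xi> n \<omega>\<bar> < inverse (real (Suc j))"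
        unfolding t_def by (rule visits)
      moreover have "\<forall>\<^sub>F n in sequentially. \<forall>x\<in>unitI. \<bar>gs n x - f x\<bar> < s / 3"
        using uniform_limitD[OF lim, of "s / 3"] \<open>s > 0\<close> by (simp add: dist_real_def)
      ultimately have "\<exists>\<^sub>F n in sequentially.
        (\<bar>Y n - of_rat q\<bar> < t \<and> \<bar>\<xi> n \<omega>\<bar> < inverse (real (Suc j))) \<and> (\<forall>x\<in>unitI. \<bar>gs n x - f x\<bar> < s / 3)"
        by (rule frequently_eventually_frequently)
      then have "\<exists>\<^sub>F n in sequentially. \<bar>Y (Suc n) - f z\<bar> < s"
      proof (rule frequently_elim1)
        fix n
        assume *: "(\<bar>Y n - of_rat q\<bar> < t \<and> \<bar>\<xi> n \<omega>\<bar> < inverse (real (Suc j))) \<and>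
          (\<forall>x\<in>unitI. \<bar>gs n x - f x\<bar> < s / 3)"
        then have "\<bar>Y n - z\<bar> < r"
          using q i unfolding t_def by linarith
        then have "\<bar>f (Y n) - f z\<bar> < s / 3"
          using r Y_in by blast
        moreover have "\<bar>gs n (Y n) - f (Y n)\<bar> < s / 3"
          using * Y_in by blast
        then have "\<bar>Y (Suc n) - f z\<bar> < s / 3 + \<bar>\<xi> n \<omega>\<bar> + \<bar>f (Y n) - f z\<bar>"
          unfolding Y_def by (intro rproc_clamp_step \<open>f z \<in> unitI\<close>)
        ultimately show "\<bar>Y (Suc n) - f z\<bar> < s"
          using * j by linarith
      qed
      then show ?thesis
        unfolding frequently_sequentially by (meson le_SucI)
    qed
    then show ?case
      unfolding Y_def by blast
  qed
qed

section \<open>Choice of constants and return from the clamped process\<close>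

theorem theorem5:
  fixes M :: "'a measure" and fs :: "nat \<Rightarrow> real \<Rightarrow> real" and f :: "real \<Rightarrow> real"
  assumes "prob_space M"
    and "\<And>n. self_map_I (fs n)"
    and "self_map_I f"
    and "uniform_limit unitI fs f sequentially"
    and "nonchaotic_stable f"
  shows "nonchaotic_rp M fs f"
  unfolding nonchaotic_rp_def
proof (intro allI impI)
  fix \<epsilon> :: real
  assume "\<epsilon> > 0"
  \<comment> \<open>Tracking costs \<open>4 * e\<close> and clamping at most \<open>e\<close>; the
    sixth part keeps the bound on the limsup strict.\<close>
  define e where "e = \<epsilon> / 6"
  have "e > 0"
    using \<open>\<epsilon> > 0\<close> by (simp add: e_def)
  then obtain \<delta>0 where "\<delta>0 > 0" and stab: "stable_at f e \<delta>0"
    using assms(5) unfolding nonchaotic_stable_def stable_at_def by blast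
  \<comment> \<open>\<open>\<delta>0\<close> keeps the noise within the range of stability, and
    \<open>e\<close> limits how far the process leaves the unit interval.\<close>
  define \<delta> where "\<delta> = min \<delta>0 e"
  have "\<delta> > 0"
    using \<open>\<delta>0 > 0\<close> \<open>e > 0\<close> by (simp add: \<delta>_def)
  moreover have "AE \<omega> in M. \<exists>p\<in>Per f.
      limsup (\<lambda>n. ereal \<bar>rproc (\<lambda>n. fs (k + n)) \<xi> x0 n \<omega> - (f ^^ n) p\<bar>) < ereal \<epsilon>"
    if \<delta>': "0 < \<delta>'" "\<delta>' < \<delta>" and "x0 \<in> unitI" and noise: "uniform_noise M \<delta>' \<xi>" for k \<delta>' x0 \<xi>
  proof -
    let ?gs = "\<lambda>n. fs (k + n)"
    have gs: "self_map_I (?gs n)" for n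
      using assms(2) .
    have lim: "uniform_limit unitI ?gs f sequentially"
      using filterlim_compose[OF assms(4) filterlim_subseq[of "\<lambda>n. k + n"]] by (simp add: strict_mono_def)
    have "AE \<omega> in M. \<forall>n. \<bar>\<xi> n \<omega>\<bar> \<le> \<delta>'"
      unfolding AE_all_countable using uniform_noise_bounded[OF assms(1) noise \<delta>'(1)] by blast
    then show ?thesis
      using rproc_accumulation_invariant[OF assms(1) noise \<delta>'(1) gs assms(3) lim, of x0]
    proof eventually_elim
      case (elim \<omega>)
      let ?X = "\<lambda>n. rproc ?gs \<xi> x0 n \<omega>"
      define Y where "Y n = clampI (?X n)" for n
      have Y_in: "Y n \<in> unitI" for n
        by (simp add: Y_def)
      have step: "\<forall>\<^sub>F n in sequentially. \<bar>Y (Suc n) - f (Y n)\<bar> < r" if "\<delta>' < r" for r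
      proof -
        have "\<forall>\<^sub>F n in sequentially. \<forall>x\<in>unitI. \<bar>?gs n x - f x\<bar> < r - \<delta>'"
          using uniform_limitD[OF lim, of "r - \<delta>'"] that by (simp add: dist_real_def)
        then show ?thesis
        proof eventually_elim
          case e: (elim n)
          have "f (Y n) \<in> unitI"
            using assms(3) Y_in unfolding self_map_I_def by blast
          moreover have "\<bar>?gs n (Y n) - f (Y n)\<bar> < r - \<delta>'"
            using e Y_in by blast
          ultimately have "\<bar>Y (Suc n) - f (Y n)\<bar> < r - \<delta>' + \<bar>\<xi> n \<omega>\<bar> + \<bar>f (Y n) - f (Y n)\<bar>"
            unfolding Y_def by (intro rproc_clamp_step)
          then show ?case
            using elim(1)[rule_format, of n] by linarith
        qed
      qed
      have inv: "\<forall>s>0. \<exists>\<^sub>F n in sequentially. \<bar>Y n - f z\<bar> < s"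
        if "z \<in> unitI" "\<forall>s>0. \<exists>\<^sub>F n in sequentially. \<bar>Y n - z\<bar> < s" for z
        using elim(2) that unfolding Y_def by blast
      have "0 \<le> \<delta>'" "\<delta>' < \<delta>0"
        using \<delta>' by (simp_all add: \<delta>_def)
      then obtain p where p: "p \<in> Per f" "\<forall>\<^sub>F n in sequentially. \<bar>Y n - (f ^^ n) p\<bar> < 4 * e"
        by (rule tracked_by_periodic_orbit[OF assms(3) stab _ _ \<open>e > 0\<close> Y_in step inv])
      \<comment> \<open>Before the noise is added, the value lies in the unit interval, so clamping
        moves the sum by at most the size of the noise.\<close>
      have near: "\<bar>?X n - Y n\<bar> \<le> \<delta>'" for n
      proof (cases n)
        case 0
        then show ?thesis
          using \<open>x0 \<in> unitI\<close> \<delta>' by (simp add: Y_def)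
      next
        case (Suc m)
        then show ?thesis
          using ext_I_in[OF gs, of m "?X m"] elim(1)[rule_format, of m]
          by (auto simp: Y_def max_def min_def abs_le_iff)
      qed
      have "\<forall>\<^sub>F n in sequentially. \<bar>?X n - (f ^^ n) p\<bar> \<le> 5 * e"
        using p(2)
      proof eventually_elim
        case (elim n)
        then show ?case
          using near[of n] \<delta>'(2) unfolding \<delta>_def by linarith
      qed
      then have "limsup (\<lambda>n. ereal \<bar>?X n - (f ^^ n) p\<bar>) \<le> ereal (5 * e)"
        by (intro Limsup_bounded) (auto elim: eventually_mono)
      also have "\<dots> < ereal \<epsilon>"
        using \<open>\<epsilon> > 0\<close> by (simp add: e_def)
      finally show ?case
        using p(1) by blast
    qed
  qed
  ultimately show "\<exists>K::nat. \<exists>\<delta>>0. \<forall>k>K. \<forall>\<delta>'. 0 < \<delta>' \<and> \<delta>' < \<delta> \<longrightarrow>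
      (\<forall>x0\<in>unitI. \<forall>\<xi>. uniform_noise M \<delta>' \<xi> \<longrightarrow>
        (AE \<omega> in M. \<exists>p\<in>Per f.
          limsup (\<lambda>n. ereal \<bar>rproc (\<lambda>n. fs (k + n)) \<xi> x0 n \<omega> - (f ^^ n) p\<bar>) < ereal \<epsilon>))"
    by blast
qed

end
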